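(* For all $n$, each of the operator spaces $M_{\infty,n}$ and $M_{n,\infty}$ is $1$-uniformly exact, with uniformity function $\mathbf n(k)=k\cdot n$.
   Context: $\mathbf K$ denotes the compact operators on $\ell^2$, viewed as infinite matrices. $M_{\infty,n}$ (respectively $M_{n,\infty}$) is the operator space of all $\infty\times n$ (respectively $n\times\infty$) matrices in $\mathbf K$, i.e. those whose entries vanish outside the first $n$ columns (respectively the first $n$ rows). $M_m$ denotes the $m\times m$ complex matrices, identified with $\mathcal L(\ell^2_m)$. For operator spaces $X,Y$, $d_{cb}(X,Y)=\inf\|T\|_{cb}\|T^{-1}\|_{cb}$ over all invertible $T:X\to Y$ with $T,T^{-1}$ completely bounded. An operator space $Z$ is $C$-uniformly exact with uniformity function $\mathbf n:\mathbb N\to\mathbb N$ if for all $k$ and all $k$-dimensional subspaces $F$ of $Z$, there exists a subspace $G\subset M_{\mathbf n(k)}$ with $d_{cb}(F,G)\le C$. *)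

theory Defs
  imports "HOL-Analysis.Analysis"
begin

section \<open>Complex Hilbert spaces\<close>

class complex_vector = real_vector +
  fixes scaleC :: "complex \<Rightarrow> 'a \<Rightarrow> 'a"  (infixr "*\<^sub>C" 75)
  assumes scaleC_add_right: "a *\<^sub>C (x + y) = a *\<^sub>C x + a *\<^sub>C y"
    and scaleC_add_left: "(a + b) *\<^sub>C x = a *\<^sub>C x + b *\<^sub>C x"
    and scaleC_scaleC: "a *\<^sub>C b *\<^sub>C x = (a * b) *\<^sub>C x"
    and scaleC_one: "1 *\<^sub>C x = x"
    and scaleR_scaleC: "r *\<^sub>R x = complex_of_real r *\<^sub>C x"

global_interpretation cvec: vector_space "scaleC :: complex \<Rightarrow> 'a \<Rightarrow> 'a::complex_vector"
  by standard (simp_all add: scaleC_add_right scaleC_add_left scaleC_scaleC scaleC_one)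

class complex_normed_vector = complex_vector + real_normed_vector +
  assumes norm_scaleC: "norm (a *\<^sub>C x) = cmod a * norm x"

text \<open>By the parallelogram law, a complex norm that comes from a real inner product comes from a
  complex inner product, so no sesquilinear form needs to be carried along.\<close>

class complex_hilbert_space = complex_normed_vector + real_inner + complete_space

lemma bounded_linear_scaleC: "bounded_linear (\<lambda>x::'a::complex_normed_vector. a *\<^sub>C x)"
  by (rule bounded_linear_intro[where K = "cmod a"])
    (simp_all add: scaleC_add_right scaleR_scaleC scaleC_scaleC norm_scaleC mult.commute)

instantiation blinfun :: (real_normed_vector, complex_normed_vector) complex_normed_vector
begin

lift_definition scaleC_blinfun :: "complex \<Rightarrow> 'a \<Rightarrow>\<^sub>L 'b \<Rightarrow> 'a \<Rightarrow>\<^sub>L 'b"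
  is "\<lambda>a T x. a *\<^sub>C T x"
  by (rule bounded_linear_compose[OF bounded_linear_scaleC])

instance
proof
  fix a b :: complex and r :: real and S T :: "'a \<Rightarrow>\<^sub>L 'b"
  show "a *\<^sub>C (S + T) = a *\<^sub>C S + a *\<^sub>C T"
    by transfer (simp add: scaleC_add_right)
  show "(a + b) *\<^sub>C T = a *\<^sub>C T + b *\<^sub>C T"
    by transfer (simp add: scaleC_add_left)
  show "a *\<^sub>C b *\<^sub>C T = (a * b) *\<^sub>C T"
    by transfer (simp add: scaleC_scaleC)
  show "1 *\<^sub>C T = T"
    by transfer (simp add: scaleC_one)
  show "r *\<^sub>R T = complex_of_real r *\<^sub>C T"
    by transfer (simp add: scaleR_scaleC)
  have le: "norm (c *\<^sub>C U) \<le> cmod c * norm U" for c and U :: "'a \<Rightarrow>\<^sub>L 'b"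
    by (rule norm_blinfun_bound)
      (simp_all add: scaleC_blinfun.rep_eq norm_scaleC norm_blinfun mult.assoc mult_left_mono)
  show "norm (a *\<^sub>C T) = cmod a * norm T"
  proof (cases "a = 0")
    case True
    then show ?thesis using le[of 0 T] by simp
  next
    case False
    have "T = (1 / a) *\<^sub>C a *\<^sub>C T"
      using False by transfer (simp add: scaleC_scaleC scaleC_one)
    then have "norm T \<le> cmod (1 / a) * norm (a *\<^sub>C T)"
      using le[of "1 / a" "a *\<^sub>C T"] by simp
    then have "cmod a * norm T \<le> norm (a *\<^sub>C T)"
      using False by (simp add: norm_divide field_simps)
    with le show ?thesis by (simp add: order_antisym)
  qed
qed

end


section \<open>The Hilbert space of square summable sequences\<close>

typedef ell2 = "{x :: nat \<Rightarrow> complex. summable (\<lambda>i. (cmod (x i))\<^sup>2)}"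
  morphisms coord Abs_ell2
  by (rule exI[of _ "\<lambda>_. 0"]) simp

setup_lifting type_definition_ell2

lemma ell2_add:
  assumes "summable (\<lambda>i. (cmod (x i))\<^sup>2)" "summable (\<lambda>i. (cmod (y i))\<^sup>2)"
  shows "summable (\<lambda>i. (cmod (x i + y i))\<^sup>2)"
proof (rule summable_comparison_test')
  show "summable (\<lambda>i. 2 * (cmod (x i))\<^sup>2 + 2 * (cmod (y i))\<^sup>2)"
    using assms by (intro summable_add summable_mult)
  fix i :: nat
  have "(cmod (x i + y i))\<^sup>2 \<le> (cmod (x i) + cmod (y i))\<^sup>2"
    by (simp add: norm_triangle_ineq power_mono)
  also have "\<dots> \<le> 2 * (cmod (x i))\<^sup>2 + 2 * (cmod (y i))\<^sup>2"
    using sum_squares_bound[of "cmod (x i)" "cmod (y i)"] by (simp add: power2_sum)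
  finally show "norm ((cmod (x i + y i))\<^sup>2) \<le> 2 * (cmod (x i))\<^sup>2 + 2 * (cmod (y i))\<^sup>2"
    by simp
qed

lemma ell2_mult: "summable (\<lambda>i. (cmod (x i))\<^sup>2) \<Longrightarrow> summable (\<lambda>i. (cmod (c * x i))\<^sup>2)"
  by (simp add: norm_mult power_mult_distrib summable_mult)

lemma summable_coord: "summable (\<lambda>i. (cmod (coord x i))\<^sup>2)"
  using coord[of x] by simp

lemma summable_inner_coord: "summable (\<lambda>i. inner (coord x i) (coord y i))"
proof (rule summable_comparison_test')
  show "summable (\<lambda>i. (cmod (coord x i))\<^sup>2 + (cmod (coord y i))\<^sup>2)"
    by (intro summable_add summable_coord)
  fix i :: nat
  have "norm (inner (coord x i) (coord y i)) \<le> cmod (coord x i) * cmod (coord y i)"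
    by (simp add: Cauchy_Schwarz_ineq2)
  also have "\<dots> \<le> (cmod (coord x i))\<^sup>2 + (cmod (coord y i))\<^sup>2"
    using sum_squares_bound[of "cmod (coord x i)" "cmod (coord y i)"]
      mult_nonneg_nonneg[OF norm_ge_zero[of "coord x i"] norm_ge_zero[of "coord y i"]]
    by linarith
  finally show "norm (inner (coord x i) (coord y i)) \<le> (cmod (coord x i))\<^sup>2 + (cmod (coord y i))\<^sup>2" .
qed

instantiation ell2 :: complex_normed_vector
begin

lift_definition zero_ell2 :: ell2 is "\<lambda>_. 0" by simp
lift_definition plus_ell2 :: "ell2 \<Rightarrow> ell2 \<Rightarrow> ell2" is "\<lambda>x y i. x i + y i" by (rule ell2_add)
lift_definition uminus_ell2 :: "ell2 \<Rightarrow> ell2" is "\<lambda>x i. - x i" by simp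
definition minus_ell2 :: "ell2 \<Rightarrow> ell2 \<Rightarrow> ell2" where "minus_ell2 x y = x + - y"
lift_definition scaleC_ell2 :: "complex \<Rightarrow> ell2 \<Rightarrow> ell2" is "\<lambda>a x i. a * x i" by (rule ell2_mult)
definition scaleR_ell2 :: "real \<Rightarrow> ell2 \<Rightarrow> ell2" where "scaleR_ell2 r x = complex_of_real r *\<^sub>C x"
definition norm_ell2 :: "ell2 \<Rightarrow> real" where "norm_ell2 x = sqrt (\<Sum>i. (cmod (coord x i))\<^sup>2)"
definition dist_ell2 :: "ell2 \<Rightarrow> ell2 \<Rightarrow> real" where "dist_ell2 x y = norm (x - y)"
definition sgn_ell2 :: "ell2 \<Rightarrow> ell2" where "sgn_ell2 x = complex_of_real (inverse (norm x)) *\<^sub>C x"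
definition uniformity_ell2 :: "(ell2 \<times> ell2) filter"
  where "uniformity_ell2 = (INF e\<in>{0 <..}. principal {(x, y). dist x y < e})"
definition open_ell2 :: "ell2 set \<Rightarrow> bool"
  where "open_ell2 U = (\<forall>x\<in>U. eventually (\<lambda>(x', y). x' = x \<longrightarrow> y \<in> U) uniformity)"

instance
proof
  fix x y z :: ell2 and a b :: complex and r s :: real
  show "x + y + z = x + (y + z)" "x + y = y + x" "0 + x = x" "- x + x = 0"
    by (transfer, simp add: algebra_simps)+
  show "x - y = x + - y" by (rule minus_ell2_def)
  show C: "a *\<^sub>C (x + y) = a *\<^sub>C x + a *\<^sub>C y" "(a + b) *\<^sub>C x = a *\<^sub>C x + b *\<^sub>C x"
    "a *\<^sub>C b *\<^sub>C x = (a * b) *\<^sub>C x" "1 *\<^sub>C x = x"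
    by (transfer, simp add: algebra_simps)+
  show "r *\<^sub>R x = complex_of_real r *\<^sub>C x" by (rule scaleR_ell2_def)
  show "r *\<^sub>R (x + y) = r *\<^sub>R x + r *\<^sub>R y" "(r + s) *\<^sub>R x = r *\<^sub>R x + s *\<^sub>R x"
    "r *\<^sub>R s *\<^sub>R x = (r * s) *\<^sub>R x" "1 *\<^sub>R x = x"
    unfolding scaleR_ell2_def by (transfer, simp add: algebra_simps)+
  show "dist x y = norm (x - y)" by (rule dist_ell2_def)
  show "sgn x = inverse (norm x) *\<^sub>R x" by (simp add: sgn_ell2_def scaleR_ell2_def)
  show "uniformity = (INF e\<in>{0 <..}. principal {(x::ell2, y). dist x y < e})"
    by (rule uniformity_ell2_def)
  show "open U = (\<forall>x\<in>U. eventually (\<lambda>(x', y). x' = x \<longrightarrow> y \<in> U) uniformity)" for U :: "ell2 set"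
    by (rule open_ell2_def)
  have nc: "norm (a *\<^sub>C x) = cmod a * norm x" for a and x :: ell2
    unfolding norm_ell2_def
    by (simp add: scaleC_ell2.rep_eq norm_mult power_mult_distrib suminf_mult summable_coord
        real_sqrt_mult)
  show "norm (a *\<^sub>C x) = cmod a * norm x" by (rule nc)
  show "norm (r *\<^sub>R x) = \<bar>r\<bar> * norm x" unfolding scaleR_ell2_def by (simp add: nc)
  have "norm x = 0 \<longleftrightarrow> (\<forall>i. coord x i = 0)"
    unfolding norm_ell2_def by (simp add: suminf_eq_zero_iff[OF summable_coord])
  then show "norm x = 0 \<longleftrightarrow> x = 0"
    by (simp add: coord_inject[symmetric] zero_ell2.rep_eq fun_eq_iff)
  have sq: "(\<Sum>i<n. (cmod (coord x i))\<^sup>2) \<le> (norm x)\<^sup>2" for n x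
    unfolding norm_ell2_def
    by (simp add: suminf_nonneg summable_coord sum_le_suminf)
  show "norm (x + y) \<le> norm x + norm y"
  proof -
    have nn: "0 \<le> norm z" for z :: ell2
      unfolding norm_ell2_def by (simp add: suminf_nonneg summable_coord)
    have "(\<Sum>i<n. (cmod (coord (x + y) i))\<^sup>2) \<le> (norm x + norm y)\<^sup>2" for n
    proof -
      have le: "L2_set (\<lambda>i. cmod (coord z i)) {..<n} \<le> norm z" for z
        unfolding L2_set_def using sq[where x = z] nn by (simp add: real_le_lsqrt sum_nonneg)
      have "L2_set (\<lambda>i. cmod (coord (x + y) i)) {..<n}
          \<le> L2_set (\<lambda>i. cmod (coord x i) + cmod (coord y i)) {..<n}"
        by (rule L2_set_mono) (simp_all add: plus_ell2.rep_eq norm_triangle_ineq)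
      also have "\<dots> \<le> L2_set (\<lambda>i. cmod (coord x i)) {..<n} + L2_set (\<lambda>i. cmod (coord y i)) {..<n}"
        by (rule L2_set_triangle_ineq)
      also have "\<dots> \<le> norm x + norm y" by (intro add_mono le)
      finally show ?thesis
        unfolding L2_set_def using nn by (simp add: sqrt_le_D)
    qed
    then have "(\<Sum>i. (cmod (coord (x + y) i))\<^sup>2) \<le> (norm x + norm y)\<^sup>2"
      by (intro suminf_le_const summable_coord)
    then show ?thesis
      using nn unfolding norm_ell2_def[of "x + y"] by (simp add: real_le_lsqrt)
  qed
qed

end

instantiation ell2 :: complex_hilbert_space
begin

definition inner_ell2 :: "ell2 \<Rightarrow> ell2 \<Rightarrow> real"
  where "inner_ell2 x y = (\<Sum>i. inner (coord x i) (coord y i))"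

instance
proof
  fix x y z :: ell2 and r :: real
  show "inner x y = inner y x"
    by (simp add: inner_ell2_def inner_commute)
  show "inner (x + y) z = inner x z + inner y z"
    by (simp add: inner_ell2_def plus_ell2.rep_eq inner_add_left suminf_add summable_inner_coord)
  show "inner (r *\<^sub>R x) y = r * inner x y"
    by (simp add: inner_ell2_def scaleR_ell2_def scaleC_ell2.rep_eq suminf_mult
        summable_inner_coord flip: scaleR_conv_of_real)
  have n: "norm x = sqrt (inner x x)" for x :: ell2
    by (simp add: norm_ell2_def inner_ell2_def power2_norm_eq_inner)
  show "norm x = sqrt (inner x x)" by (rule n)
  show nonneg: "0 \<le> inner x x"
    by (simp add: inner_ell2_def suminf_nonneg summable_inner_coord)
  show "inner x x = 0 \<longleftrightarrow> x = 0"
    using n[of x] by (metis norm_eq_zero real_sqrt_eq_zero_cancel_iff)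
next
  fix X :: "nat \<Rightarrow> ell2"
  assume X: "Cauchy X"
  have part: "(\<Sum>i<n. (cmod (coord x i))\<^sup>2) \<le> (norm x)\<^sup>2" for n and x :: ell2
    unfolding norm_ell2_def by (simp add: suminf_nonneg summable_coord sum_le_suminf)
  have coord_le: "cmod (coord x i) \<le> norm x" for i and x :: ell2
  proof (rule power2_le_imp_le)
    have "(cmod (coord x i))\<^sup>2 \<le> (\<Sum>j<Suc i. (cmod (coord x j))\<^sup>2)"
      by (rule member_le_sum) auto
    also have "\<dots> \<le> (norm x)\<^sup>2" by (rule part)
    finally show "(cmod (coord x i))\<^sup>2 \<le> (norm x)\<^sup>2" .
  qed simp
  have cdiff: "coord (x - y) i = coord x i - coord y i" for x y i
    by (metis minus_ell2_def plus_ell2.rep_eq uminus_ell2.rep_eq add_uminus_conv_diff)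
  have "Cauchy (\<lambda>m. coord (X m) i)" for i
  proof (rule metric_CauchyI)
    fix e :: real
    assume "0 < e"
    with X obtain M where "\<forall>m\<ge>M. \<forall>k\<ge>M. dist (X m) (X k) < e"
      unfolding Cauchy_def by blast
    then show "\<exists>M. \<forall>m\<ge>M. \<forall>k\<ge>M. dist (coord (X m) i) (coord (X k) i) < e"
      unfolding dist_norm by (metis coord_le cdiff le_less_trans)
  qed
  then obtain y where y: "\<And>i. (\<lambda>m. coord (X m) i) \<longlonglongrightarrow> y i"
    unfolding Cauchy_convergent_iff convergent_def by metis
  have tail: "\<exists>M. \<forall>m\<ge>M. \<forall>n. (\<Sum>i<n. (cmod (coord (X m) i - y i))\<^sup>2) \<le> e\<^sup>2" if "0 < e" for e
  proof -
    from X that obtain M where M: "\<And>m k. m \<ge> M \<Longrightarrow> k \<ge> M \<Longrightarrow> norm (X m - X k) < e"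
      unfolding Cauchy_def dist_norm by blast
    have "(\<Sum>i<n. (cmod (coord (X m) i - y i))\<^sup>2) \<le> e\<^sup>2" if "m \<ge> M" for m n
    proof (rule tendsto_upperbound)
      show "(\<lambda>k. \<Sum>i<n. (cmod (coord (X m) i - coord (X k) i))\<^sup>2)
          \<longlonglongrightarrow> (\<Sum>i<n. (cmod (coord (X m) i - y i))\<^sup>2)"
        by (intro tendsto_intros y)
      have "(\<Sum>i<n. (cmod (coord (X m) i - coord (X k) i))\<^sup>2) \<le> e\<^sup>2" if "k \<ge> M" for k
        using part[of "X m - X k" n] M[OF \<open>m \<ge> M\<close> that]
        by (simp add: cdiff) (meson less_imp_le norm_ge_zero order_trans power_mono)
      then show "\<forall>\<^sub>F k in sequentially. (\<Sum>i<n. (cmod (coord (X m) i - coord (X k) i))\<^sup>2) \<le> e\<^sup>2"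
        unfolding eventually_sequentially by blast
    qed simp
    then show ?thesis by blast
  qed
  have sm: "summable (\<lambda>i. (cmod (coord (X m) i - y i))\<^sup>2)"
    if "\<forall>n. (\<Sum>i<n. (cmod (coord (X m) i - y i))\<^sup>2) \<le> c" for m c
    by (rule bounded_imp_summable[where B = c])
      (use that in \<open>simp_all add: lessThan_Suc_atMost[symmetric] del: sum.lessThan_Suc\<close>)
  obtain M1 where "summable (\<lambda>i. (cmod (coord (X M1) i - y i))\<^sup>2)"
    using tail[of 1] sm by (metis le_refl zero_less_one)
  from ell2_add[OF summable_coord[of "X M1"] ell2_mult[OF this, of "-1"]]
  have "summable (\<lambda>i. (cmod (y i))\<^sup>2)" by simp
  then have cy: "coord (Abs_ell2 y) = y" by (simp add: Abs_ell2_inverse)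
  have "X \<longlonglongrightarrow> Abs_ell2 y"
  proof (rule metric_LIMSEQ_I)
    fix e :: real
    assume "0 < e"
    then obtain M where M: "\<And>m n. m \<ge> M \<Longrightarrow> (\<Sum>i<n. (cmod (coord (X m) i - y i))\<^sup>2) \<le> (e/2)\<^sup>2"
      using tail[of "e/2"] by auto
    have "dist (X m) (Abs_ell2 y) < e" if "m \<ge> M" for m
    proof -
      have "(\<Sum>i. (cmod (coord (X m) i - y i))\<^sup>2) \<le> (e/2)\<^sup>2"
        using M[OF that] by (intro suminf_le_const sm) auto
      then have "norm (X m - Abs_ell2 y) \<le> e/2"
        unfolding norm_ell2_def cdiff cy using \<open>0 < e\<close> by (intro real_le_lsqrt) auto
      then show ?thesis using \<open>0 < e\<close> by (simp add: dist_norm)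
    qed
    then show "\<exists>M. \<forall>m\<ge>M. dist (X m) (Abs_ell2 y) < e" by blast
  qed
  then show "convergent X" by (auto simp: convergent_def)
qed

end

lift_definition unit_ell2 :: "nat \<Rightarrow> ell2" is "\<lambda>j i. if i = j then 1 else 0"
proof -
  fix j :: nat
  have "summable (\<lambda>i. if i = j then 1 else (0::real))" by (rule summable_single)
  then show "summable (\<lambda>i. (cmod (if i = j then 1 else 0))\<^sup>2)"
    by (rule back_subst[of summable]) auto
qed


section \<open>Operator spaces\<close>

text \<open>The type of bounded operators on a Hilbert space only records real linearity.\<close>

definition complex_linear :: "('a::complex_normed_vector \<Rightarrow>\<^sub>L 'b::complex_normed_vector) \<Rightarrow> bool"
  where "complex_linear T \<longleftrightarrow> Vector_Spaces.linear (*\<^sub>C) (*\<^sub>C) (blinfun_apply T)"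

definition operator_space :: "('h::complex_hilbert_space \<Rightarrow>\<^sub>L 'h) set \<Rightarrow> bool"
  where "operator_space X \<longleftrightarrow> cvec.subspace X \<and> closed X \<and> (\<forall>T\<in>X. complex_linear T)"

text \<open>The norm of a \<open>k \<times> k\<close> matrix of operators, acting on the Hilbert space direct sum of \<open>k\<close>
  copies of the underlying space; only the entries \<open>A i j\<close> with \<open>i, j < k\<close> matter.\<close>

definition mat_norm :: "nat \<Rightarrow> (nat \<Rightarrow> nat \<Rightarrow> 'h::complex_hilbert_space \<Rightarrow>\<^sub>L 'h) \<Rightarrow> real"
  where "mat_norm k A = (SUP x\<in>{x. L2_set (\<lambda>j. norm (x j)) {..<k} \<le> 1}.
    L2_set (\<lambda>i. norm (\<Sum>j<k. A i j (x j))) {..<k})"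

text \<open>The supremum of a set of reals that is not bounded above would be a junk value.\<close>

lemma mat_norm_bdd:
  fixes A :: "nat \<Rightarrow> nat \<Rightarrow> 'h::complex_hilbert_space \<Rightarrow>\<^sub>L 'h"
  shows "bdd_above ((\<lambda>x. L2_set (\<lambda>i. norm (\<Sum>j<k. blinfun_apply (A i j) (x j))) {..<k}) `
    {x. L2_set (\<lambda>j. norm (x j)) {..<k} \<le> 1})"
proof (rule bdd_aboveI2)
  fix x :: "nat \<Rightarrow> 'h"
  assume "x \<in> {x. L2_set (\<lambda>j. norm (x j)) {..<k} \<le> 1}"
  then have x: "norm (x j) \<le> 1" if "j < k" for j
    using member_le_L2_set[of "{..<k}" j "\<lambda>j. norm (x j)"] that by simp
  have "norm (blinfun_apply (A i j) (x j)) \<le> norm (A i j)" if "j < k" for i j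
    using norm_blinfun[of "A i j" "x j"] x[OF that]
    by (meson mult_left_le norm_ge_zero order_trans)
  then have *: "norm (\<Sum>j<k. blinfun_apply (A i j) (x j)) \<le> (\<Sum>j<k. norm (A i j))" for i
    by (intro order_trans[OF norm_sum] sum_mono) simp
  have "L2_set (\<lambda>i. norm (\<Sum>j<k. blinfun_apply (A i j) (x j))) {..<k}
      \<le> (\<Sum>i<k. norm (\<Sum>j<k. blinfun_apply (A i j) (x j)))"
    by (rule L2_set_le_sum) simp
  also have "\<dots> \<le> (\<Sum>i<k. \<Sum>j<k. norm (A i j))" by (intro sum_mono *)
  finally show "L2_set (\<lambda>i. norm (\<Sum>j<k. blinfun_apply (A i j) (x j))) {..<k}
      \<le> (\<Sum>i<k. \<Sum>j<k. norm (A i j))" .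
qed

text \<open>A map between operator spaces is a function on all operators; only its values on the
  domain \<open>X\<close> matter.\<close>

definition cb_norm :: "('h \<Rightarrow>\<^sub>L 'h) set \<Rightarrow>
    (('h::complex_hilbert_space \<Rightarrow>\<^sub>L 'h) \<Rightarrow> ('k::complex_hilbert_space \<Rightarrow>\<^sub>L 'k)) \<Rightarrow> ennreal"
  where "cb_norm X u = (SUP k. SUP A\<in>{A. (\<forall>i<k. \<forall>j<k. A i j \<in> X) \<and> mat_norm k A \<le> 1}.
    ennreal (mat_norm k (\<lambda>i j. u (A i j))))"

definition linear_iso :: "('h \<Rightarrow>\<^sub>L 'h) set \<Rightarrow> ('k \<Rightarrow>\<^sub>L 'k) set \<Rightarrow>
    (('h::complex_hilbert_space \<Rightarrow>\<^sub>L 'h) \<Rightarrow> ('k::complex_hilbert_space \<Rightarrow>\<^sub>L 'k)) \<Rightarrow> bool"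
  where "linear_iso X Y u \<longleftrightarrow> bij_betw u X Y \<and>
    (\<forall>S\<in>X. \<forall>T\<in>X. u (S + T) = u S + u T) \<and> (\<forall>c. \<forall>T\<in>X. u (c *\<^sub>C T) = c *\<^sub>C u T)"

text \<open>The distance is \<open>\<infinity>\<close> if there is no completely bounded isomorphism.\<close>

definition d_cb :: "('h::complex_hilbert_space \<Rightarrow>\<^sub>L 'h) set \<Rightarrow> ('k::complex_hilbert_space \<Rightarrow>\<^sub>L 'k) set \<Rightarrow> ennreal"
  where "d_cb X Y = (INF u\<in>{u. linear_iso X Y u \<and> cb_norm X u < \<infinity> \<and> cb_norm Y (inv_into X u) < \<infinity>}.
    cb_norm X u * cb_norm Y (inv_into X u))"

definition subspace_of_dim :: "nat \<Rightarrow> 'a::complex_vector set \<Rightarrow> bool"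
  where "subspace_of_dim k F \<longleftrightarrow>
    (\<exists>B. finite B \<and> card B = k \<and> cvec.independent B \<and> cvec.span B = F)"


section \<open>Spaces of matrices\<close>

definition entry :: "(ell2 \<Rightarrow>\<^sub>L ell2) \<Rightarrow> nat \<Rightarrow> nat \<Rightarrow> complex"
  where "entry T i j = coord (T (unit_ell2 j)) i"

definition compact_operators :: "(ell2 \<Rightarrow>\<^sub>L ell2) set"
  where "compact_operators = {T. complex_linear T \<and> compact (closure (blinfun_apply T ` cball 0 1))}"

definition M_inf_cols :: "nat \<Rightarrow> (ell2 \<Rightarrow>\<^sub>L ell2) set"
  where "M_inf_cols n = {T \<in> compact_operators. \<forall>i j. n \<le> j \<longrightarrow> entry T i j = 0}"

definition M_inf_rows :: "nat \<Rightarrow> (ell2 \<Rightarrow>\<^sub>L ell2) set"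
  where "M_inf_rows n = {T \<in> compact_operators. \<forall>i j. n \<le> i \<longrightarrow> entry T i j = 0}"

lemma complex_linear_iff:
  "complex_linear T \<longleftrightarrow> (\<forall>c x. blinfun_apply T (c *\<^sub>C x) = c *\<^sub>C blinfun_apply T x)"
proof
  assume "complex_linear T"
  then show "\<forall>c x. blinfun_apply T (c *\<^sub>C x) = c *\<^sub>C blinfun_apply T x"
    unfolding complex_linear_def by (simp add: Vector_Spaces.linear_iff)
next
  assume "\<forall>c x. blinfun_apply T (c *\<^sub>C x) = c *\<^sub>C blinfun_apply T x"
  then show "complex_linear T"
    unfolding complex_linear_def Vector_Spaces.linear_iff
    by (simp add: blinfun.add_right cvec.vector_space_axioms)
qed

lemma tendsto_scaleC:
  "(f \<longlongrightarrow> l) F \<Longrightarrow> ((\<lambda>x. c *\<^sub>C f x) \<longlongrightarrow> c *\<^sub>C (l::'a::complex_normed_vector)) F"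
  by (rule bounded_linear.tendsto[OF bounded_linear_scaleC])

lemma coord_le_norm: "cmod (coord x i) \<le> norm x"
proof (rule power2_le_imp_le)
  have "(cmod (coord x i))\<^sup>2 \<le> (\<Sum>j<Suc i. (cmod (coord x j))\<^sup>2)"
    by (rule member_le_sum) auto
  also have "\<dots> \<le> (norm x)\<^sup>2" 
    unfolding norm_ell2_def by (simp add: suminf_nonneg summable_coord sum_le_suminf del: sum.lessThan_Suc)
  finally show "(cmod (coord x i))\<^sup>2 \<le> (norm x)\<^sup>2" .
qed simp

lemma bounded_linear_coord: "bounded_linear (\<lambda>x. coord x i)"
  by (rule bounded_linear_intro[where K = 1])
    (simp_all add: plus_ell2.rep_eq scaleR_ell2_def scaleC_ell2.rep_eq coord_le_norm scaleR_conv_of_real)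

lemma entry_lin: "entry (S + T) i j = entry S i j + entry T i j"
  "entry (c *\<^sub>C T) i j = c * entry T i j" "entry 0 i j = 0"
  by (simp_all add: entry_def plus_blinfun.rep_eq scaleC_blinfun.rep_eq plus_ell2.rep_eq scaleC_ell2.rep_eq zero_blinfun.rep_eq zero_ell2.rep_eq)

lemma subspace_compact_operators: "cvec.subspace compact_operators"
  unfolding cvec.subspace_def
proof (intro conjI ballI allI)
  have "(\<lambda>_::ell2. 0::ell2) ` cball 0 1 \<subseteq> {0}" by auto
  then have "compact (closure ((\<lambda>_::ell2. 0::ell2) ` cball 0 1))"
    by (simp add: image_constant_conv)
  then show "0 \<in> compact_operators"
    unfolding compact_operators_def mem_Collect_eq
    by (intro conjI) (simp_all only: complex_linear_iff zero_blinfun.rep_eq cvec.scale_zero_right simp_thms)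
next
  fix S T assume S: "S \<in> compact_operators" and T: "T \<in> compact_operators"
  let ?S = "closure (blinfun_apply S ` cball 0 1)" and ?T = "closure (blinfun_apply T ` cball 0 1)"
  have c: "compact {x + y |x y. x \<in> ?S \<and> y \<in> ?T}"
    using S T by (intro compact_sums) (auto simp: compact_operators_def)
  have "blinfun_apply (S + T) ` cball 0 1 \<subseteq> {x + y |x y. x \<in> ?S \<and> y \<in> ?T}"
  proof (rule image_subsetI)
    fix x :: ell2 assume "x \<in> cball 0 1"
    then have "S x \<in> ?S" "T x \<in> ?T" by (meson closure_subset imageI subsetD)+
    then show "(S + T) x \<in> {x + y |x y. x \<in> ?S \<and> y \<in> ?T}"
      unfolding plus_blinfun.rep_eq by blast
  qed
  then have "closure (blinfun_apply (S + T) ` cball 0 1) \<subseteq> {x + y |x y. x \<in> ?S \<and> y \<in> ?T}"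
    by (rule closure_minimal[OF _ compact_imp_closed[OF c]])
  then have "compact (closure (blinfun_apply (S + T) ` cball 0 1))"
    by (rule subst[where P = compact, OF Int_absorb1 compact_Int_closed[OF c closed_closure]])
  then show "S + T \<in> compact_operators"
    using S T by (simp add: compact_operators_def complex_linear_iff plus_blinfun.rep_eq scaleC_add_right)
next
  fix c T assume T: "T \<in> compact_operators"
  let ?T = "closure (blinfun_apply T ` cball 0 1)"
  have c: "compact ((*\<^sub>C) c ` ?T)"
    using T by (intro compact_continuous_image linear_continuous_on bounded_linear_scaleC)
      (auto simp: compact_operators_def)
  have "blinfun_apply (c *\<^sub>C T) ` cball 0 1 \<subseteq> (*\<^sub>C) c ` ?T"
  proof (rule image_subsetI)
    fix x :: ell2 assume "x \<in> cball 0 1"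
    then have "T x \<in> ?T" by (meson closure_subset imageI subsetD)
    then show "(c *\<^sub>C T) x \<in> (*\<^sub>C) c ` ?T"
      unfolding scaleC_blinfun.rep_eq by (rule imageI)
  qed
  then have "closure (blinfun_apply (c *\<^sub>C T) ` cball 0 1) \<subseteq> (*\<^sub>C) c ` ?T"
    by (rule closure_minimal[OF _ compact_imp_closed[OF c]])
  then have "compact (closure (blinfun_apply (c *\<^sub>C T) ` cball 0 1))"
    by (rule subst[where P = compact, OF Int_absorb1 compact_Int_closed[OF c closed_closure]])
  then show "c *\<^sub>C T \<in> compact_operators"
    using T by (simp add: compact_operators_def complex_linear_iff scaleC_blinfun.rep_eq scaleC_scaleC)
qed

lemma closed_compact_operators: "closed compact_operators"
  unfolding closed_sequential_limits
proof (intro allI impI, elim conjE)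
  fix X :: "nat \<Rightarrow> ell2 \<Rightarrow>\<^sub>L ell2" and T
  assume X: "\<forall>n. X n \<in> compact_operators" and lim: "X \<longlonglongrightarrow> T"
  have ptw: "(\<lambda>n. X n x) \<longlonglongrightarrow> T x" for x
    by (intro tendsto_intros lim)
  have "complex_linear T"
    unfolding complex_linear_iff
  proof (intro allI)
    fix c x
    have "(\<lambda>n. X n (c *\<^sub>C x)) \<longlonglongrightarrow> c *\<^sub>C T x"
      using tendsto_scaleC[OF ptw, of c x] X by (simp add: compact_operators_def complex_linear_iff)
    with ptw show "T (c *\<^sub>C x) = c *\<^sub>C T x" by (rule LIMSEQ_unique)
  qed
  moreover have "compact (closure (blinfun_apply T ` cball 0 1))"
    unfolding compact_eq_totally_bounded
  proof (intro conjI allI impI)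
    show "complete (closure (blinfun_apply T ` cball 0 1))"
      by (simp add: complete_eq_closed)
    fix e :: real assume "0 < e"
    then have e: "0 < e/4" by simp
    obtain N where N: "norm (X N - T) < e/4"
      using LIMSEQ_D[OF lim e] by (meson order_refl)
    have "compact (closure (blinfun_apply (X N) ` cball 0 1))"
      using X by (simp add: compact_operators_def)
    then have "\<exists>k. finite k \<and> closure (blinfun_apply (X N) ` cball 0 1) \<subseteq> (\<Union>x\<in>k. ball x (e/4))"
      unfolding compact_eq_totally_bounded using e by (elim conjE allE[of _ "e/4"] impE)
    then obtain k where k: "finite k"
      "closure (blinfun_apply (X N) ` cball 0 1) \<subseteq> (\<Union>x\<in>k. ball x (e/4))"
      by (elim exE conjE)
    have "blinfun_apply T ` cball 0 1 \<subseteq> (\<Union>x\<in>k. cball x (e/2))"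
    proof (rule image_subsetI)
      fix x :: ell2 assume x: "x \<in> cball 0 1"
      have "X N x \<in> (\<Union>x\<in>k. ball x (e/4))"
        using x by (intro subsetD[OF k(2)] subsetD[OF closure_subset] imageI)
      then obtain y where y: "y \<in> k" "dist y (X N x) < e/4" by auto
      have "norm ((X N - T) x) \<le> norm (X N - T) * norm x" by (rule norm_blinfun)
      also have "\<dots> \<le> norm (X N - T)" using x by (simp add: mult_left_le)
      finally have "dist (X N x) (T x) < e/4"
        using N by (simp add: dist_norm minus_blinfun.rep_eq)
      with y have "dist y (T x) < e/2" using dist_triangle[of y "T x" "X N x"] by simp
      with y(1) show "T x \<in> (\<Union>x\<in>k. cball x (e/2))" by (auto intro: less_imp_le)
    qed
    moreover have "closed (\<Union>x\<in>k. cball x (e/2))" using k(1) by (intro closed_UN) auto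
    ultimately have "closure (blinfun_apply T ` cball 0 1) \<subseteq> (\<Union>x\<in>k. cball x (e/2))"
      by (rule closure_minimal)
    also have "\<dots> \<subseteq> (\<Union>x\<in>k. ball x e)" using \<open>0 < e\<close> by (intro UN_mono) auto
    finally show "\<exists>k. finite k \<and> closure (blinfun_apply T ` cball 0 1) \<subseteq> (\<Union>x\<in>k. ball x e)"
      using k(1) by blast
  qed
  ultimately show "T \<in> compact_operators" by (simp add: compact_operators_def)
qed

lemma operator_space_pattern:
  "operator_space {T \<in> compact_operators. \<forall>i j. P i j \<longrightarrow> entry T i j = 0}"
  unfolding operator_space_def
proof (intro conjI)
  show "cvec.subspace {T \<in> compact_operators. \<forall>i j. P i j \<longrightarrow> entry T i j = 0}"
    using subspace_compact_operators unfolding cvec.subspace_def by (simp add: entry_lin)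
  have "closed {T. entry T i j = 0}" for i j
  proof -
    have "continuous_on UNIV (\<lambda>T. entry T i j)"
      unfolding entry_def
      by (intro bounded_linear.continuous_on[OF bounded_linear_coord] continuous_intros)
    then show ?thesis
      by (intro closed_Collect_eq) (auto intro: continuous_on_const)
  qed
  then have "closed (compact_operators \<inter> (\<Inter>i. \<Inter>j\<in>{j. P i j}. {T. entry T i j = 0}))"
    by (intro closed_Int closed_compact_operators closed_INT ballI) auto
  also have "compact_operators \<inter> (\<Inter>i. \<Inter>j\<in>{j. P i j}. {T. entry T i j = 0})
      = {T \<in> compact_operators. \<forall>i j. P i j \<longrightarrow> entry T i j = 0}"
    by auto
  finally show "closed {T \<in> compact_operators. \<forall>i j. P i j \<longrightarrow> entry T i j = 0}" .
qed (auto simp: compact_operators_def)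

lemma operator_space_M_inf_cols: "operator_space (M_inf_cols n)"
  and operator_space_M_inf_rows: "operator_space (M_inf_rows n)"
  unfolding M_inf_cols_def M_inf_rows_def by (rule operator_space_pattern)+

text \<open>The operators on the \<open>m\<close>-dimensional Hilbert space, realised as the upper left corner of the
  operators on the square summable sequences (a completely isometric embedding).\<close>

definition M_fin :: "nat \<Rightarrow> (ell2 \<Rightarrow>\<^sub>L ell2) set"
  where "M_fin m = {T. complex_linear T \<and> (\<forall>i j. m \<le> i \<or> m \<le> j \<longrightarrow> entry T i j = 0)}"

definition uniformly_exact :: "real \<Rightarrow> (nat \<Rightarrow> nat) \<Rightarrow> ('h::complex_hilbert_space \<Rightarrow>\<^sub>L 'h) set \<Rightarrow> bool"
  where "uniformly_exact C N Z \<longleftrightarrow> operator_space Z \<and>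
    (\<forall>k F. subspace_of_dim k F \<and> F \<subseteq> Z \<longrightarrow>
      (\<exists>G. cvec.subspace G \<and> G \<subseteq> M_fin (N k) \<and> d_cb F G \<le> ennreal C))"

end

theory Submission
  imports Defs
begin

text \<open>Every \<open>k\<close>-dimensional subspace \<open>F\<close> of \<open>M_inf_cols n\<close> or \<open>M_inf_rows n\<close> is completely
  isometric to a space of matrices of size \<open>k * n\<close>, because a basis of \<open>F\<close> consists of \<open>k\<close>
  matrices with \<open>n\<close> columns (rows) each, and so involves only \<open>k * n\<close> vectors of \<open>\<ell>\<^sup>2\<close>.

  Take columns first. Each \<open>T\<close> in \<open>F\<close> is supported on the first \<open>n\<close> unit vectors, so its range lies in
  the span \<open>H\<close> of the \<open>k * n\<close> columns of the basis. By Gram-Schmidt \<open>H\<close> has an orthonormal basis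
  \<open>v 0, \<dots>, v (r - 1)\<close> with \<open>r \<le> k * n\<close>. Let \<open>W\<close> be the partial isometry that takes \<open>v i\<close> to the \<open>i\<close>th
  unit vector and vanishes on the orthogonal complement of \<open>H\<close>, and \<open>V\<close> its adjoint. Then \<open>V W\<close> is the
  projection onto \<open>H\<close>, so \<open>T \<mapsto> W T\<close> has the inverse \<open>S \<mapsto> V S\<close>. Left multiplication by a contraction
  does not increase matrix norms, so both maps are complete contractions, and the rows of \<open>W T\<close> vanish
  from index \<open>r\<close> on, while its columns still vanish from index \<open>n\<close> on.

  For rows the argument is dual. The first \<open>n\<close> coordinates of \<open>T x\<close> for the basis elements \<open>T\<close> are
  \<open>k * n\<close> functionals of \<open>x\<close>, each the inner product with some vector; with \<open>H\<close> the span of these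
  vectors, \<open>T = T V W\<close> for all \<open>T\<close> in \<open>F\<close>, and \<open>T \<mapsto> T V\<close> with inverse \<open>S \<mapsto> S W\<close> does the job.

  Both \<open>W\<close> and \<open>V\<close>, and the projection too, are instances of \<open>frame_map\<close>; the lemmas that carry the
  proof are \<open>norm_frame_map_le\<close>, \<open>Gram_Schmidt\<close> and \<open>d_cb_image_le_1\<close>.\<close>

section \<open>The complex inner product\<close>

text \<open>The sesquilinear form that polarization recovers from the real inner product; it is linear in the
  first argument, whence the value \<open>inner x (\<i> *\<^sub>C y)\<close>, and not its negative, as imaginary part.\<close>

definition cinner :: "'a::complex_hilbert_space \<Rightarrow> 'a \<Rightarrow> complex"
  where "cinner x y = Complex (inner x y) (inner x (\<i> *\<^sub>C y))"

lemma scaleC_ii_ii: "\<i> *\<^sub>C \<i> *\<^sub>C x = - (x::'a::complex_vector)"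
proof -
  have "\<i> *\<^sub>C \<i> *\<^sub>C x = (-1) *\<^sub>C x" by (simp add: scaleC_scaleC)
  also have "\<dots> = - x" by (metis cvec.scale_minus_left scaleC_one)
  finally show ?thesis .
qed

text \<open>Multiplication by \<open>\<i>\<close> preserves the norm, and the norm determines the real inner product. This is
  what makes \<open>cinner\<close> complex linear.\<close>

lemma inner_scaleC_ii_ii: "inner (\<i> *\<^sub>C x) (\<i> *\<^sub>C y) = inner x (y::'a::complex_hilbert_space)"
  unfolding dot_norm by (simp add: norm_scaleC flip: scaleC_add_right)

lemma inner_scaleC_ii_left: "inner (\<i> *\<^sub>C x) y = - inner x (\<i> *\<^sub>C (y::'a::complex_hilbert_space))"
  using inner_scaleC_ii_ii[of "\<i> *\<^sub>C x" y] by (simp add: scaleC_ii_ii)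

lemma scaleC_Re_Im: "c *\<^sub>C x = Re c *\<^sub>R x + Im c *\<^sub>R \<i> *\<^sub>C (x::'a::complex_vector)"
proof -
  have "c *\<^sub>C x = (complex_of_real (Re c) + complex_of_real (Im c) * \<i>) *\<^sub>C x"
    by (simp add: complex_eq_iff)
  then show ?thesis
    by (simp only: scaleR_scaleC scaleC_add_left scaleC_scaleC)
qed

lemma Re_cinner: "Re (cinner x y) = inner x y"
  by (simp add: cinner_def)

lemma cinner_scaleC_left: "cinner (c *\<^sub>C x) y = c * cinner x y"
  unfolding scaleC_Re_Im[of c x] cinner_def
  by (simp add: complex_eq_iff inner_add_left inner_scaleC_ii_left inner_scaleC_ii_ii scaleC_ii_ii)

lemma cinner_commute: "cinner y x = cnj (cinner x y)"
  by (simp add: cinner_def complex_eq_iff inner_commute[of y] inner_scaleC_ii_left)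

lemma bounded_linear_cinner_left: "bounded_linear (\<lambda>x. cinner x y)"
proof -
  have "bounded_linear (\<lambda>x. complex_of_real (inner x y) + \<i> * complex_of_real (inner x (\<i> *\<^sub>C y)))"
    by (intro bounded_linear_add bounded_linear_compose[OF bounded_linear_mult_right]
        bounded_linear_compose[OF bounded_linear_of_real] bounded_linear_inner_left)
  then show ?thesis by (simp add: cinner_def Complex_eq)
qed

lemmas cinner_diff_left = linear_diff[OF bounded_linear.linear[OF bounded_linear_cinner_left]]
lemmas cinner_sum_left = linear_sum[OF bounded_linear.linear[OF bounded_linear_cinner_left]]
lemmas cinner_zero_left = linear_0[OF bounded_linear.linear[OF bounded_linear_cinner_left]]

lemma cinner_scaleC_right: "cinner x (c *\<^sub>C y) = cnj c * cinner x y"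
  by (metis cinner_commute cinner_scaleC_left complex_cnj_mult)

lemma cinner_sum_right: "cinner x (sum f A) = (\<Sum>i\<in>A. cinner x (f i))"
  by (subst cinner_commute) (simp add: cinner_sum_left flip: cinner_commute)

lemma cinner_self: "cinner x x = complex_of_real ((norm x)\<^sup>2)"
  using inner_scaleC_ii_left[of x x]
  by (simp add: cinner_def complex_eq_iff power2_norm_eq_inner inner_commute)


section \<open>Maps between orthonormal families\<close>

definition orthonormal :: "nat \<Rightarrow> (nat \<Rightarrow> 'a::complex_hilbert_space) \<Rightarrow> bool"
  where "orthonormal r v \<longleftrightarrow> (\<forall>i<r. \<forall>j<r. cinner (v i) (v j) = (if i = j then 1 else 0))"

text \<open>For orthonormal families this is the partial isometry that takes \<open>a i\<close> to \<open>b i\<close>, for \<open>i < r\<close>, and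
  vanishes on the orthogonal complement of the \<open>a i\<close>. For \<open>a = b\<close> it is the orthogonal projection onto
  their span.\<close>

lift_definition frame_map :: "nat \<Rightarrow> (nat \<Rightarrow> 'a::complex_hilbert_space) \<Rightarrow>
    (nat \<Rightarrow> 'b::complex_hilbert_space) \<Rightarrow> 'a \<Rightarrow>\<^sub>L 'b"
  is "\<lambda>r a b x. \<Sum>i<r. cinner x (a i) *\<^sub>C b i"
proof (rule bounded_linear_sum)
  fix a :: "nat \<Rightarrow> 'a" and b :: "nat \<Rightarrow> 'b" and i
  have "bounded_linear (\<lambda>c::complex. c *\<^sub>C b i)"
    by (rule bounded_linear_intro[where K = "norm (b i)"])
      (simp_all add: scaleC_add_left scaleR_scaleC scaleC_scaleC norm_scaleC scaleR_conv_of_real)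
  then show "bounded_linear (\<lambda>x. cinner x (a i) *\<^sub>C b i)"
    by (rule bounded_linear_compose[OF _ bounded_linear_cinner_left])
qed

lemma complex_linear_frame_map: "frame_map r a b (c *\<^sub>C x) = c *\<^sub>C frame_map r a b x"
  by (simp add: frame_map.rep_eq cinner_scaleC_left cvec.scale_sum_right scaleC_scaleC)

lemma sum_mult_delta:
  "j < (r::nat) \<Longrightarrow> (\<Sum>i<r. c i * (if i = j then 1 else 0)) = (c j :: complex)"
  by (simp add: if_distrib[of "\<lambda>x. _ * x"] cong: if_cong)

lemma cinner_orthonormal_sum:
  assumes "orthonormal r b" "j < r"
  shows "cinner (\<Sum>i<r. c i *\<^sub>C b i) (b j) = c j"
proof -
  have "cinner (\<Sum>i<r. c i *\<^sub>C b i) (b j) = (\<Sum>i<r. c i * cinner (b i) (b j))"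
    by (simp add: cinner_sum_left cinner_scaleC_left)
  also have "\<dots> = (\<Sum>i<r. c i * (if i = j then 1 else 0))"
    using assms by (intro sum.cong) (auto simp: orthonormal_def)
  finally show ?thesis using assms by (simp add: sum_mult_delta)
qed

lemma norm_orthonormal_sum:
  assumes "orthonormal r b"
  shows "(norm (\<Sum>i<r. c i *\<^sub>C b i))\<^sup>2 = (\<Sum>i<r. (cmod (c i))\<^sup>2)"
proof -
  let ?p = "\<Sum>i<r. c i *\<^sub>C b i"
  have "cinner ?p ?p = (\<Sum>i<r. cnj (c i) * cinner ?p (b i))"
    by (subst cinner_sum_right) (simp add: cinner_scaleC_right)
  also have "\<dots> = (\<Sum>i<r. cnj (c i) * c i)"
    by (simp add: cinner_orthonormal_sum[OF assms])
  also have "\<dots> = complex_of_real (\<Sum>i<r. (cmod (c i))\<^sup>2)"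
    unfolding of_real_sum complex_norm_square by (simp add: mult.commute)
  finally show ?thesis by (simp only: cinner_self of_real_eq_iff)
qed

lemma cinner_frame_map:
  "orthonormal r b \<Longrightarrow> j < r \<Longrightarrow> cinner (frame_map r a b x) (b j) = cinner x (a j)"
  unfolding frame_map.rep_eq by (rule cinner_orthonormal_sum)

lemma frame_map_frame_map:
  "orthonormal r b \<Longrightarrow> frame_map r b c (frame_map r a b x) = frame_map r a c x"
  by (simp add: frame_map.rep_eq[of r b c] cinner_frame_map) (simp add: frame_map.rep_eq)

lemma cinner_projection_left:
  "cinner (frame_map r v v x) y = (\<Sum>i<r. cinner x (v i) * cinner (v i) y)"
  by (simp add: frame_map.rep_eq cinner_sum_left cinner_scaleC_left)

lemma cinner_projection_symmetric:
  "cinner (frame_map r v v x) y = cinner x (frame_map r v v y)"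
proof -
  have "cinner x (frame_map r v v y) = cnj (\<Sum>i<r. cinner y (v i) * cinner (v i) x)"
    by (metis cinner_commute cinner_projection_left)
  also have "\<dots> = (\<Sum>i<r. cinner x (v i) * cinner (v i) y)"
    by (simp add: mult.commute flip: cinner_commute)
  finally show ?thesis by (simp add: cinner_projection_left)
qed

text \<open>Bessel's inequality: the projection \<open>p\<close> of \<open>x\<close> satisfies \<open>\<langle>x, p\<rangle> = \<langle>p, p\<rangle>\<close>, so Cauchy-Schwarz gives
  \<open>\<parallel>p\<parallel> \<le> \<parallel>x\<parallel>\<close>. The image has the same coefficients in the other orthonormal family, hence the same
  norm as \<open>p\<close>.\<close>

lemma norm_frame_map_le:
  assumes "orthonormal r a" "orthonormal r b"
  shows "norm (frame_map r a b x) \<le> norm x"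
proof -
  let ?p = "frame_map r a a x"
  have "inner x ?p = inner ?p ?p"
    using cinner_projection_symmetric[of r a x ?p] frame_map_frame_map[OF assms(1), of a a x]
    by (metis Re_cinner cinner_projection_symmetric)
  then have "norm ?p * norm ?p \<le> norm x * norm ?p"
    using norm_cauchy_schwarz[of x ?p] by (simp add: power2_norm_eq_inner flip: power2_eq_square)
  then have "norm ?p \<le> norm x"
    by (cases "norm ?p = 0") auto
  moreover have "(norm (frame_map r a b x))\<^sup>2 = (norm ?p)\<^sup>2"
    using assms by (simp add: frame_map.rep_eq norm_orthonormal_sum)
  ultimately show ?thesis by simp
qed

text \<open>The span of the orthonormal family is not mentioned: that the projection fixes every \<open>s\<close> in \<open>S\<close> is
  the form in which \<open>S\<close> being contained in it is used.\<close>

lemma Gram_Schmidt: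
  assumes "finite S"
  shows "\<exists>r v. r \<le> card S \<and> orthonormal r v \<and> (\<forall>s\<in>S. frame_map r v v s = s)"
  using assms
proof induction
  case empty
  show ?case by (intro exI[of _ 0]) (simp add: orthonormal_def)
next
  case (insert s S)
  then obtain r v where r: "r \<le> card S" and v: "orthonormal r v"
    and S: "\<And>t. t \<in> S \<Longrightarrow> frame_map r v v t = t"
    by blast
  \<comment> \<open>The component of the new vector orthogonal to the family found so far; if it does not vanish, its
    normalization is the next member.\<close>
  define d where "d = s - frame_map r v v s"
  have dv: "cinner d (v i) = 0" if "i < r" for i
    using that v by (simp add: d_def cinner_diff_left cinner_frame_map)
  then have vd: "cinner (v i) d = 0" if "i < r" for i
    using that by (metis cinner_commute complex_cnj_zero)
  have Pd: "cinner (frame_map r v v x) d = 0" for x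
    by (simp add: cinner_projection_left vd)
  show ?case
  proof (cases "d = 0")
    case True
    then have "frame_map r v v s = s" by (simp add: d_def)
    with r v S insert.hyps show ?thesis by (intro exI[of _ r] exI[of _ v]) auto
  next
    case False
    define n where "n = complex_of_real (norm d)"
    have n: "n \<noteq> 0" "cnj n = n" "cinner d d = n * n"
      using False by (simp_all add: n_def cinner_self power2_eq_square)
    define w where "w = v(r := (1 / n) *\<^sub>C d)"
    have ow: "orthonormal (Suc r) w"
      using v n by (auto simp: orthonormal_def less_Suc_eq w_def cinner_scaleC_left cinner_scaleC_right dv vd)
    have Pw: "frame_map (Suc r) w w x = frame_map r v v x + (cinner x d / (n * n)) *\<^sub>C d" for x
      using n by (simp add: frame_map.rep_eq w_def cinner_scaleC_right scaleC_scaleC)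
    have "frame_map (Suc r) w w t = t" if "t \<in> S" for t
      using Pd[of t] S[OF that] by (simp add: Pw)
    moreover have "cinner s d = n * n"
      using Pd[of s] n(3) by (simp add: d_def cinner_diff_left)
    then have "frame_map (Suc r) w w s = s"
      using n by (simp add: Pw scaleC_one) (simp add: d_def)
    ultimately show ?thesis
      using r ow insert.hyps by (intro exI[of _ "Suc r"] exI[of _ w]) auto
  qed
qed


section \<open>Coordinates in the space of square summable sequences\<close>

lemma cinner_unit_ell2: "cinner x (unit_ell2 i) = coord x i"
proof -
  have *: "inner x (c *\<^sub>C unit_ell2 i) = inner (coord x i) c" for c
  proof -
    have "(\<lambda>j. inner (coord x j) (coord (c *\<^sub>C unit_ell2 i) j)) = (\<lambda>j. if j = i then inner (coord x j) c else 0)"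
      by (auto simp: scaleC_ell2.rep_eq unit_ell2.rep_eq)
    then show ?thesis
      unfolding inner_ell2_def using sums_unique[OF sums_single[of i "\<lambda>j. inner (coord x j) c"]] by simp
  qed
  from *[of 1] *[of \<i>] show ?thesis
    by (simp add: cinner_def complex_eq_iff scaleC_one inner_complex_def)
qed

lemma orthonormal_unit_ell2: "orthonormal r unit_ell2"
  by (auto simp: orthonormal_def cinner_unit_ell2 unit_ell2.rep_eq)

lemma coord_simps: "coord 0 i = 0" "coord (c *\<^sub>C x) i = c * coord x i"
  by (simp_all add: zero_ell2.rep_eq scaleC_ell2.rep_eq)

lemma coord_frame_map_unit: "coord (frame_map r a unit_ell2 x) i = (if i < r then cinner x (a i) else 0)"
proof -
  have "coord (frame_map r a unit_ell2 x) i = (\<Sum>j<r. cinner x (a j) * (if i = j then 1 else 0))"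
    unfolding frame_map.rep_eq
    by (simp add: linear_sum[OF bounded_linear.linear[OF bounded_linear_coord]] coord_simps
        unit_ell2.rep_eq)
  then show ?thesis
    by (simp add: if_distrib[of "\<lambda>x. _ * x"] cong: if_cong)
qed

lemma frame_map_unit_ell2_eq_0: "r \<le> i \<Longrightarrow> frame_map r unit_ell2 a (unit_ell2 i) = 0"
  by (simp add: frame_map.rep_eq cinner_unit_ell2 unit_ell2.rep_eq)

text \<open>Truncations converge: by Pythagoras the squared error is the tail of the series for
  \<open>(norm x)\<^sup>2\<close>. Hence a bounded complex linear map is determined by its values on the unit vectors.\<close>

lemma frame_map_unit_tendsto: "(\<lambda>r. frame_map r unit_ell2 unit_ell2 x) \<longlonglongrightarrow> x"
proof -
  let ?s = "\<lambda>r. frame_map r unit_ell2 unit_ell2 x"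
  have "(norm (?s r - x))\<^sup>2 = (norm x)\<^sup>2 - (\<Sum>i<r. (cmod (coord x i))\<^sup>2)" for r
  proof -
    have "inner x (?s r) = inner (?s r) (?s r)"
      by (metis Re_cinner cinner_projection_symmetric frame_map_frame_map orthonormal_unit_ell2)
    moreover have "inner (?s r) (?s r) = (\<Sum>i<r. (cmod (coord x i))\<^sup>2)"
      unfolding power2_norm_eq_inner[symmetric]
      by (simp add: frame_map.rep_eq norm_orthonormal_sum orthonormal_unit_ell2 cinner_unit_ell2)
    ultimately show ?thesis
      by (simp add: power2_norm_eq_inner inner_diff_left inner_diff_right inner_commute)
  qed
  moreover have "(\<lambda>r. (norm x)\<^sup>2 - (\<Sum>i<r. (cmod (coord x i))\<^sup>2)) \<longlonglongrightarrow> (norm x)\<^sup>2 - (norm x)\<^sup>2"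
    unfolding norm_ell2_def
    by (intro tendsto_diff tendsto_const)
      (simp add: suminf_nonneg summable_coord summable_LIMSEQ)
  ultimately have "(\<lambda>r. (norm (?s r - x))\<^sup>2) \<longlonglongrightarrow> 0" by simp
  then have "(\<lambda>r. sqrt ((norm (?s r - x))\<^sup>2)) \<longlonglongrightarrow> sqrt 0" by (rule tendsto_real_sqrt)
  then show ?thesis by (simp add: tendsto_norm_zero_iff LIM_zero_cancel)
qed

lemma complex_linear_eqI:
  fixes S T :: "ell2 \<Rightarrow>\<^sub>L 'a::complex_hilbert_space"
  assumes "complex_linear S" "complex_linear T" "\<And>j. S (unit_ell2 j) = T (unit_ell2 j)"
  shows "S = T"
proof (rule blinfun_eqI)
  fix x
  have "S (frame_map r unit_ell2 unit_ell2 x) = T (frame_map r unit_ell2 unit_ell2 x)" for r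
    using assms by (simp add: frame_map.rep_eq blinfun.sum_right complex_linear_iff)
  moreover have "(\<lambda>r. S (frame_map r unit_ell2 unit_ell2 x)) \<longlonglongrightarrow> S x"
    "(\<lambda>r. T (frame_map r unit_ell2 unit_ell2 x)) \<longlonglongrightarrow> T x"
    by (intro tendsto_intros frame_map_unit_tendsto)+
  ultimately show "S x = T x" using LIMSEQ_unique by simp
qed

text \<open>The Riesz representation of a coordinate functional of \<open>T\<close>. The representing vector \<open>g\<close> is the
  conjugate of the \<open>i\<close>th row of \<open>T\<close>, so all that needs an argument is that this row is square summable;
  the identity then extends from the unit vectors by density.\<close>

lemma coord_eq_cinner:
  fixes T :: "ell2 \<Rightarrow>\<^sub>L ell2"
  assumes T: "complex_linear T"
  obtains g where "\<And>x. coord (T x) i = cinner x g" "\<And>j. coord g j = cnj (entry T i j)"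
proof -
  define h where "h r = (\<Sum>j<r. cnj (entry T i j) *\<^sub>C unit_ell2 j)" for r
  have Th: "coord (T (\<Sum>j<r. c j *\<^sub>C unit_ell2 j)) i = (\<Sum>j<r. c j * entry T i j)" for r c
    using T unfolding blinfun.sum_right complex_linear_iff
    by (simp add: linear_sum[OF bounded_linear.linear[OF bounded_linear_coord]] coord_simps entry_def)
  \<comment> \<open>Testing \<open>T\<close> on the truncation \<open>h r\<close> of the conjugate row gives
    \<open>(norm (h r))\<^sup>2 \<le> norm T * norm (h r)\<close>.\<close>
  have "(\<Sum>j<r. (cmod (entry T i j))\<^sup>2) \<le> (norm T)\<^sup>2" for r
  proof -
    have h: "(norm (h r))\<^sup>2 = (\<Sum>j<r. (cmod (entry T i j))\<^sup>2)"
      by (simp add: h_def norm_orthonormal_sum orthonormal_unit_ell2)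
    have "coord (T (h r)) i = complex_of_real ((norm (h r))\<^sup>2)"
      unfolding h unfolding h_def Th of_real_sum complex_norm_square by (simp add: mult.commute)
    then have "(norm (h r))\<^sup>2 \<le> norm (T (h r))"
      using coord_le_norm[of "T (h r)" i] by (simp add: norm_power)
    also have "\<dots> \<le> norm T * norm (h r)" by (rule norm_blinfun)
    finally have "norm (h r) \<le> norm T"
      by (cases "norm (h r) = 0") (simp_all add: power2_eq_square)
    then show ?thesis unfolding h[symmetric] by (simp add: power_mono)
  qed
  then have "summable (\<lambda>j. (cmod (cnj (entry T i j)))\<^sup>2)"
    by (intro bounded_imp_summable[where B = "(norm T)\<^sup>2"])
      (simp_all add: lessThan_Suc_atMost[symmetric] del: sum.lessThan_Suc)
  then have g: "coord (Abs_ell2 (\<lambda>j. cnj (entry T i j))) j = cnj (entry T i j)" for j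
    by (simp add: Abs_ell2_inverse)
  let ?g = "Abs_ell2 (\<lambda>j. cnj (entry T i j))"
  show thesis
  proof (rule that[OF _ g])
    fix x
    have "coord (T (frame_map r unit_ell2 unit_ell2 x)) i = cinner (frame_map r unit_ell2 unit_ell2 x) ?g" for r
    proof -
      have "cinner (unit_ell2 j) ?g = entry T i j" for j
        by (subst cinner_commute) (simp add: cinner_unit_ell2 g)
      then show ?thesis
        by (simp add: frame_map.rep_eq Th cinner_sum_left cinner_scaleC_left)
    qed
    moreover have "(\<lambda>r. coord (T (frame_map r unit_ell2 unit_ell2 x)) i) \<longlonglongrightarrow> coord (T x) i"
      by (intro bounded_linear.tendsto[OF bounded_linear_coord] tendsto_intros frame_map_unit_tendsto)
    moreover have "(\<lambda>r. cinner (frame_map r unit_ell2 unit_ell2 x) ?g) \<longlonglongrightarrow> cinner x ?g"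
      by (intro bounded_linear.tendsto[OF bounded_linear_cinner_left] frame_map_unit_tendsto)
    ultimately show "coord (T x) i = cinner x ?g" using LIMSEQ_unique by simp
  qed
qed

lemma zero_row:
  assumes "complex_linear T" "\<And>j. entry T i j = 0"
  shows "coord (T x) i = 0"
proof -
  obtain g where g: "\<And>x. coord (T x) i = cinner x g" "\<And>j. coord g j = cnj (entry T i j)"
    using coord_eq_cinner[OF assms(1)] by metis
  have "g = 0"
    using g(2) assms(2) by (simp add: coord_inject[symmetric] fun_eq_iff zero_ell2.rep_eq)
  then show ?thesis
    using g(1)[of x] cinner_commute[of x g] by (simp add: cinner_zero_left)
qed


section \<open>Complete contractions\<close>

text \<open>Multiplying all entries by \<open>V\<close> from the left means applying \<open>V\<close> to each component of the output
  vector; from the right, to each component of the input vector, which then stays in the unit ball.\<close>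

lemma mat_norm_compose_left_le:
  fixes V :: "'h::complex_hilbert_space \<Rightarrow>\<^sub>L 'h"
  assumes "\<And>x. norm (V x) \<le> norm x"
  shows "mat_norm k (\<lambda>i j. V o\<^sub>L A i j) \<le> mat_norm k A"
  unfolding mat_norm_def
proof (rule cSUP_mono[OF _ mat_norm_bdd])
  show "{x::nat \<Rightarrow> 'h. L2_set (\<lambda>j. norm (x j)) {..<k} \<le> 1} \<noteq> {}"
    by (auto intro!: exI[of _ "\<lambda>_. 0"] simp: L2_set_def)
  fix x :: "nat \<Rightarrow> 'h" assume x: "x \<in> {x. L2_set (\<lambda>j. norm (x j)) {..<k} \<le> 1}"
  have "L2_set (\<lambda>i. norm (\<Sum>j<k. (V o\<^sub>L A i j) (x j))) {..<k}
      = L2_set (\<lambda>i. norm (V (\<Sum>j<k. A i j (x j)))) {..<k}"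
    by (simp add: blinfun.sum_right)
  also have "\<dots> \<le> L2_set (\<lambda>i. norm (\<Sum>j<k. A i j (x j))) {..<k}"
    by (intro L2_set_mono assms norm_ge_zero)
  finally show "\<exists>y\<in>{x. L2_set (\<lambda>j. norm (x j)) {..<k} \<le> 1}.
      L2_set (\<lambda>i. norm (\<Sum>j<k. (V o\<^sub>L A i j) (x j))) {..<k}
      \<le> L2_set (\<lambda>i. norm (\<Sum>j<k. A i j (y j))) {..<k}"
    using x by blast
qed

lemma mat_norm_compose_right_le:
  fixes V :: "'h::complex_hilbert_space \<Rightarrow>\<^sub>L 'h"
  assumes "\<And>x. norm (V x) \<le> norm x"
  shows "mat_norm k (\<lambda>i j. A i j o\<^sub>L V) \<le> mat_norm k A"
  unfolding mat_norm_def
proof (rule cSUP_mono[OF _ mat_norm_bdd])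
  show "{x::nat \<Rightarrow> 'h. L2_set (\<lambda>j. norm (x j)) {..<k} \<le> 1} \<noteq> {}"
    by (auto intro!: exI[of _ "\<lambda>_. 0"] simp: L2_set_def)
  fix x :: "nat \<Rightarrow> 'h" assume x: "x \<in> {x. L2_set (\<lambda>j. norm (x j)) {..<k} \<le> 1}"
  have "L2_set (\<lambda>j. norm (V (x j))) {..<k} \<le> L2_set (\<lambda>j. norm (x j)) {..<k}"
    by (intro L2_set_mono assms norm_ge_zero)
  with x have "(\<lambda>j. V (x j)) \<in> {x. L2_set (\<lambda>j. norm (x j)) {..<k} \<le> 1}" by simp
  then show "\<exists>y\<in>{x. L2_set (\<lambda>j. norm (x j)) {..<k} \<le> 1}.
      L2_set (\<lambda>i. norm (\<Sum>j<k. (A i j o\<^sub>L V) (x j))) {..<k}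
      \<le> L2_set (\<lambda>i. norm (\<Sum>j<k. A i j (y j))) {..<k}"
    by (rule bexI[rotated]) simp
qed

text \<open>The contractive map \<open>w\<close> is defined on all operators, while \<open>u\<close> need only agree with it on \<open>X\<close>: this
  admits \<open>inv_into F u\<close>, whose values off the image of \<open>F\<close> are arbitrary.\<close>

lemma cb_norm_le_1:
  assumes "\<And>T. T \<in> X \<Longrightarrow> u T = w T" "\<And>k A. mat_norm k (\<lambda>i j. w (A i j)) \<le> mat_norm k A"
  shows "cb_norm X u \<le> 1"
  unfolding cb_norm_def
proof (intro SUP_least)
  fix k and A :: "nat \<Rightarrow> nat \<Rightarrow> 'a \<Rightarrow>\<^sub>L 'a"
  assume A: "A \<in> {A. (\<forall>i<k. \<forall>j<k. A i j \<in> X) \<and> mat_norm k A \<le> 1}"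
  have "mat_norm k (\<lambda>i j. u (A i j)) = mat_norm k (\<lambda>i j. w (A i j))"
    unfolding mat_norm_def using A assms(1)
    by (intro arg_cong[where f = Sup] image_cong refl L2_set_cong arg_cong[where f = norm] sum.cong) auto
  also have "\<dots> \<le> 1" using assms(2)[of k A] A by auto
  finally show "ennreal (mat_norm k (\<lambda>i j. u (A i j))) \<le> 1" by simp
qed

lemma d_cb_image_le_1:
  fixes u :: "('h::complex_hilbert_space \<Rightarrow>\<^sub>L 'h) \<Rightarrow> ('k::complex_hilbert_space \<Rightarrow>\<^sub>L 'k)"
  assumes add: "\<And>S T. u (S + T) = u S + u T" and scale: "\<And>c T. u (c *\<^sub>C T) = c *\<^sub>C u T"
    and wu: "\<And>T. T \<in> F \<Longrightarrow> w (u T) = T"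
    and u: "\<And>k A. mat_norm k (\<lambda>i j. u (A i j)) \<le> mat_norm k A"
    and w: "\<And>k A. mat_norm k (\<lambda>i j. w (A i j)) \<le> mat_norm k A"
  shows "d_cb F (u ` F) \<le> 1"
proof -
  have inj: "inj_on u F" using wu by (metis inj_on_inverseI)
  then have "linear_iso F (u ` F) u"
    unfolding linear_iso_def by (simp add: add scale inj_on_imp_bij_betw)
  moreover have 1: "cb_norm F u \<le> 1" by (rule cb_norm_le_1[OF refl u])
  moreover have 2: "cb_norm (u ` F) (inv_into F u) \<le> 1"
    by (rule cb_norm_le_1[OF _ w]) (use inj wu in auto)
  ultimately have "d_cb F (u ` F) \<le> cb_norm F u * cb_norm (u ` F) (inv_into F u)"
    unfolding d_cb_def by (intro INF_lower) (auto intro: le_less_trans)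
  also have "\<dots> \<le> 1 * 1" by (intro mult_mono 1 2) auto
  finally show ?thesis by simp
qed

lemma subspace_image:
  assumes "cvec.subspace F" "\<And>S T. u (S + T) = u S + u T" "\<And>c T. u (c *\<^sub>C T) = c *\<^sub>C u T"
  shows "cvec.subspace (u ` F)"
proof -
  have "u 0 = 0" using assms(3)[of 0 0] by simp
  then show ?thesis
    using assms unfolding cvec.subspace_def by (auto simp flip: assms(2,3) intro!: imageI)
qed

lemma blinfun_compose_scaleC_left: "(c *\<^sub>C T) o\<^sub>L V = c *\<^sub>C (T o\<^sub>L V)"
  by (rule blinfun_eqI) (simp add: scaleC_blinfun.rep_eq)

lemma blinfun_compose_scaleC_right:
  "complex_linear V \<Longrightarrow> V o\<^sub>L (c *\<^sub>C T) = c *\<^sub>C (V o\<^sub>L T)"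
  by (rule blinfun_eqI) (simp add: scaleC_blinfun.rep_eq complex_linear_iff)

lemmas blinfun_compose_add =
  bounded_bilinear.add_left[OF bounded_bilinear_blinfun_compose]
  bounded_bilinear.add_right[OF bounded_bilinear_blinfun_compose]

lemma subspace_fixed_left:
  fixes V :: "'a::complex_normed_vector \<Rightarrow>\<^sub>L 'a"
  assumes "complex_linear V"
  shows "cvec.subspace {T :: 'b::real_normed_vector \<Rightarrow>\<^sub>L 'a. V o\<^sub>L T = T}"
  by (simp add: cvec.subspace_def blinfun_compose_add blinfun_compose_scaleC_right[OF assms]
      bounded_bilinear.zero_right[OF bounded_bilinear_blinfun_compose])

lemma subspace_fixed_right:
  fixes V :: "'a::real_normed_vector \<Rightarrow>\<^sub>L 'a"
  shows "cvec.subspace {T :: 'a \<Rightarrow>\<^sub>L 'b::complex_normed_vector. T o\<^sub>L V = T}"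
  by (simp add: cvec.subspace_def blinfun_compose_add blinfun_compose_scaleC_left
      bounded_bilinear.zero_left[OF bounded_bilinear_blinfun_compose])

text \<open>Combines the two ways in which an index pair can lie outside the \<open>k * n\<close> corner, given that the
  index \<open>j\<close> on the short side is below \<open>n\<close>: for \<open>k > 0\<close> only the other index can be too large, and for
  \<open>k = 0\<close> the bound \<open>r\<close> is \<open>0\<close>.\<close>

lemma index_bound: "r \<le> k * n \<Longrightarrow> j < n \<Longrightarrow> k * n \<le> i \<or> k * n \<le> j \<Longrightarrow> r \<le> (i::nat)"
  by (cases k) auto

lemma card_image_times_le:
  assumes "finite B"
  shows "card ((\<lambda>(b, j). f b j) ` (B \<times> {..<n})) \<le> card B * n"
  using card_image_le[of "B \<times> {..<n}" "\<lambda>(b, j). f b j"] assms by (simp add: card_cartesian_product)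


section \<open>Finite-dimensional spaces of matrices with finitely many columns or rows\<close>

text \<open>The vectors fed to Gram-Schmidt are the first \<open>n\<close> columns of the elements of \<open>B\<close>. The projection onto
  their span fixes the elements of \<open>B\<close> from the left, hence everything in \<open>cvec.span B\<close>.\<close>

lemma span_in_M_inf_cols_embeds_in_M_fin:
  assumes B: "finite B" and F: "cvec.span B \<subseteq> M_inf_cols n"
  shows "\<exists>G. cvec.subspace G \<and> G \<subseteq> M_fin (card B * n) \<and> d_cb (cvec.span B) G \<le> 1"
proof -
  have lin: "complex_linear T" if "T \<in> cvec.span B" for T
    using that F by (auto simp: M_inf_cols_def compact_operators_def)
  have zero: "T (unit_ell2 j) = 0" if "T \<in> cvec.span B" "n \<le> j" for T j
    using that F by (auto simp: M_inf_cols_def entry_def coord_inject[symmetric] fun_eq_iff zero_ell2.rep_eq)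
  let ?S = "(\<lambda>(b, j). blinfun_apply b (unit_ell2 j)) ` (B \<times> {..<n})"
  have "finite ?S" using B by simp
  from Gram_Schmidt[OF this] obtain r v
    where r: "r \<le> card ?S" and v: "orthonormal r v" and S: "\<And>s. s \<in> ?S \<Longrightarrow> frame_map r v v s = s"
    by blast
  have r: "r \<le> card B * n"
    using r card_image_times_le[OF B, of "\<lambda>b j. blinfun_apply b (unit_ell2 j)" n] by (rule order_trans)
  let ?W = "frame_map r v unit_ell2" and ?V = "frame_map r unit_ell2 v"
  let ?u = "\<lambda>T. ?W o\<^sub>L T"
  have linW: "complex_linear ?W" by (simp add: complex_linear_iff complex_linear_frame_map)
  have *: "cvec.span B \<subseteq> {T. frame_map r v v o\<^sub>L T = T}"
  proof (rule cvec.span_minimal)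
    show "cvec.subspace {T. frame_map r v v o\<^sub>L T = T}"
      by (rule subspace_fixed_left) (simp add: complex_linear_iff complex_linear_frame_map)
    show "B \<subseteq> {T. frame_map r v v o\<^sub>L T = T}"
    proof
      fix b assume b: "b \<in> B"
      then have bs: "b \<in> cvec.span B" by (rule cvec.span_base)
      have "frame_map r v v o\<^sub>L b = b"
      proof (rule complex_linear_eqI)
        show "complex_linear b" "complex_linear (frame_map r v v o\<^sub>L b)"
          using lin[OF bs] by (simp_all add: complex_linear_iff complex_linear_frame_map)
        show "(frame_map r v v o\<^sub>L b) (unit_ell2 j) = b (unit_ell2 j)" for j
        proof (cases "j < n")
          case True
          with b have "b (unit_ell2 j) \<in> ?S" by (auto intro!: image_eqI[of _ _ "(b, j)"])
          then show ?thesis by (simp add: S)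
        next
          case False
          then show ?thesis by (simp add: zero[OF bs] blinfun.zero_right)
        qed
      qed
      then show "b \<in> {T. frame_map r v v o\<^sub>L T = T}" by simp
    qed
  qed
  have P: "frame_map r v v (T x) = T x" if "T \<in> cvec.span B" for T x
  proof -
    have "frame_map r v v o\<^sub>L T = T" using that * by blast
    then show ?thesis by (metis blinfun_apply_blinfun_compose)
  qed
  have "d_cb (cvec.span B) (?u ` cvec.span B) \<le> 1"
  proof (rule d_cb_image_le_1[where w = "\<lambda>T. ?V o\<^sub>L T"])
    show "?V o\<^sub>L (?W o\<^sub>L T) = T" if "T \<in> cvec.span B" for T
      by (rule blinfun_eqI) (simp add: frame_map_frame_map orthonormal_unit_ell2 P[OF that])
  qed (simp_all add: blinfun_compose_add blinfun_compose_scaleC_right linW mat_norm_compose_left_le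
      norm_frame_map_le v orthonormal_unit_ell2)
  moreover have "cvec.subspace (?u ` cvec.span B)"
    by (intro subspace_image cvec.subspace_span blinfun_compose_add blinfun_compose_scaleC_right linW)
  moreover have "?W o\<^sub>L T \<in> M_fin (card B * n)" if T: "T \<in> cvec.span B" for T
  proof -
    have "entry (?W o\<^sub>L T) i j = 0" if "card B * n \<le> i \<or> card B * n \<le> j" for i j
    proof (cases "n \<le> j")
      case True
      then show ?thesis by (simp add: entry_def zero[OF T] blinfun.zero_right coord_simps)
    next
      case False
      then have "r \<le> i"
        using index_bound[OF r, of j i] that by auto
      then show ?thesis by (simp add: entry_def coord_frame_map_unit)
    qed
    then show ?thesis
      using lin[OF T] by (auto simp: M_fin_def complex_linear_iff complex_linear_frame_map)
  qed
  ultimately show ?thesis by blast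
qed

text \<open>The vectors fed to Gram-Schmidt are the representing vectors of the first \<open>n\<close> coordinates of the
  elements of \<open>B\<close>. As the projection is self-adjoint and fixes these vectors, it can be absorbed by the
  elements of \<open>B\<close> from the right.\<close>

lemma span_in_M_inf_rows_embeds_in_M_fin:
  assumes B: "finite B" and F: "cvec.span B \<subseteq> M_inf_rows n"
  shows "\<exists>G. cvec.subspace G \<and> G \<subseteq> M_fin (card B * n) \<and> d_cb (cvec.span B) G \<le> 1"
proof -
  have lin: "complex_linear T" if "T \<in> cvec.span B" for T
    using that F by (auto simp: M_inf_rows_def compact_operators_def)
  have zero: "coord (T x) i = 0" if "T \<in> cvec.span B" "n \<le> i" for T x i
    using that F by (intro zero_row lin) (auto simp: M_inf_rows_def)
  have "\<exists>g. \<forall>x. coord (b x) i = cinner x g" if "b \<in> cvec.span B" for b i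
    using coord_eq_cinner[OF lin[OF that], of i] by metis
  then obtain g where g: "\<And>b i x. b \<in> cvec.span B \<Longrightarrow> coord (blinfun_apply b x) i = cinner x (g b i)"
    by metis
  let ?S = "(\<lambda>(b, i). g b i) ` (B \<times> {..<n})"
  have "finite ?S" using B by simp
  from Gram_Schmidt[OF this] obtain r v
    where r: "r \<le> card ?S" and v: "orthonormal r v" and S: "\<And>s. s \<in> ?S \<Longrightarrow> frame_map r v v s = s"
    by blast
  have r: "r \<le> card B * n"
    using r card_image_times_le[OF B, of g n] by (rule order_trans)
  let ?W = "frame_map r v unit_ell2" and ?V = "frame_map r unit_ell2 v"
  let ?u = "\<lambda>T. T o\<^sub>L ?V"
  have *: "cvec.span B \<subseteq> {T. T o\<^sub>L frame_map r v v = T}"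
  proof (rule cvec.span_minimal)
    show "cvec.subspace {T. T o\<^sub>L frame_map r v v = T}"
      by (rule subspace_fixed_right)
    show "B \<subseteq> {T. T o\<^sub>L frame_map r v v = T}"
    proof
      fix b assume b: "b \<in> B"
      then have bs: "b \<in> cvec.span B" by (rule cvec.span_base)
      have "coord (b (frame_map r v v x)) i = coord (b x) i" for x i
      proof (cases "i < n")
        case True
        with b have "frame_map r v v (g b i) = g b i"
          by (intro S) (auto intro!: image_eqI[of _ _ "(b, i)"])
        then show ?thesis by (simp add: g[OF bs] cinner_projection_symmetric)
      next
        case False
        then show ?thesis by (simp add: zero[OF bs])
      qed
      then show "b \<in> {T. T o\<^sub>L frame_map r v v = T}"
        by (auto intro!: blinfun_eqI simp: coord_inject[symmetric] fun_eq_iff)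
    qed
  qed
  have P: "T (frame_map r v v x) = T x" if "T \<in> cvec.span B" for T x
  proof -
    have "T o\<^sub>L frame_map r v v = T" using that * by blast
    then show ?thesis by (metis blinfun_apply_blinfun_compose)
  qed
  have "d_cb (cvec.span B) (?u ` cvec.span B) \<le> 1"
  proof (rule d_cb_image_le_1[where w = "\<lambda>T. T o\<^sub>L ?W"])
    show "T o\<^sub>L ?V o\<^sub>L ?W = T" if "T \<in> cvec.span B" for T
      by (rule blinfun_eqI) (simp add: frame_map_frame_map orthonormal_unit_ell2 P[OF that])
  qed (simp_all add: blinfun_compose_add blinfun_compose_scaleC_left mat_norm_compose_right_le
      norm_frame_map_le v orthonormal_unit_ell2)
  moreover have "cvec.subspace (?u ` cvec.span B)"
    by (intro subspace_image cvec.subspace_span blinfun_compose_add blinfun_compose_scaleC_left)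
  moreover have "T o\<^sub>L ?V \<in> M_fin (card B * n)" if T: "T \<in> cvec.span B" for T
  proof -
    have "entry (T o\<^sub>L ?V) i j = 0" if "card B * n \<le> i \<or> card B * n \<le> j" for i j
    proof (cases "n \<le> i")
      case True
      then show ?thesis by (simp add: entry_def zero[OF T])
    next
      case False
      then have "r \<le> j"
        using index_bound[OF r, of i j] that by auto
      then show ?thesis by (simp add: entry_def frame_map_unit_ell2_eq_0 blinfun.zero_right coord_simps)
    qed
    then show ?thesis
      using lin[OF T] by (auto simp: M_fin_def complex_linear_iff complex_linear_frame_map)
  qed
  ultimately show ?thesis by blast
qed

theorem proposition2p6:
  fixes n :: nat
  shows "uniformly_exact 1 (\<lambda>k. k * n) (M_inf_cols n) \<and>
    uniformly_exact 1 (\<lambda>k. k * n) (M_inf_rows n)"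
  unfolding uniformly_exact_def subspace_of_dim_def
  using span_in_M_inf_cols_embeds_in_M_fin[where n = n] span_in_M_inf_rows_embeds_in_M_fin[where n = n]
    operator_space_M_inf_cols operator_space_M_inf_rows
  by auto

end
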